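(* Let $r \geq 2$ be even. For every integer $k \geq r+1$ there exist infinitely many (pairwise non-isomorphic) nut graphs $G$ with $o_v(G) = r$ and $o_e(G) = k$.
   Context: A nut graph is a simple connected graph whose adjacency matrix has one-dimensional kernel spanned by a vector with no zero entry. $o_v(G)$ and $o_e(G)$ are the numbers of orbits of the full automorphism group $\mathrm{Aut}(G)$ on vertices and edges, respectively. *)

theory Defs
  imports
    "Graph_Theory.Graph_Theory"
    "Jordan_Normal_Form.Matrix_Kernel"
    "HOL-Algebra.Group_Action"
    "HOL-Combinatorics.Permutations"
begin

text \<open>
  A finite simple graph is a symmetric loop-free \<^typ>\<open>'a pair_pre_digraph\<close>
  (\<^locale>\<open>pair_graph\<close>): each undirected edge is stored as its two arcs.
\<close>

definition edges :: "'a pair_pre_digraph \<Rightarrow> 'a set set" where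
  "edges G = {{u, v} | u v. (u, v) \<in> parcs G}"

text \<open>
  Rows and columns are indexed by the vertices in increasing order; the linear order only
  serves to fix an enumeration of the vertex set.
\<close>

definition adj_mat :: "'a :: linorder pair_pre_digraph \<Rightarrow> real mat" where
  "adj_mat G =
     (let vs = sorted_list_of_set (pverts G); n = card (pverts G)
      in mat n n (\<lambda>(i, j). if (vs ! i, vs ! j) \<in> parcs G then 1 else 0))"

definition nut_graph :: "'a :: linorder pair_pre_digraph \<Rightarrow> bool" where
  "nut_graph G \<longleftrightarrow>
     pair_graph G \<and> Digraph_Component.connected (with_proj G) \<and>
     kernel_dim (adj_mat G) = 1 \<and>
     (\<exists>x \<in> mat_kernel (adj_mat G).
        mat_kernel (adj_mat G) = {c \<cdot>\<^sub>v x | c. True} \<and>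
        (\<forall>i < card (pverts G). x $ i \<noteq> 0))"

text \<open>
  Requiring \<open>f permutes pverts G\<close> makes \<open>f\<close> the identity outside the vertex set, so that
  distinct elements of the carrier are distinct automorphisms.
\<close>

definition aut_group :: "'a pair_pre_digraph \<Rightarrow> ('a \<Rightarrow> 'a) monoid" where
  "aut_group G =
     \<lparr>carrier = {f. f permutes pverts G \<and>
        (\<forall>u \<in> pverts G. \<forall>v \<in> pverts G. (f u, f v) \<in> parcs G \<longleftrightarrow> (u, v) \<in> parcs G)},
      mult = (\<circ>), one = id\<rparr>"

lemma group_aut_group: "group (aut_group G)"
proof (rule groupI)
  fix f assume f: "f \<in> carrier (aut_group G)"
  then have p: "f permutes pverts G"
    and e: "\<And>u v. u \<in> pverts G \<Longrightarrow> v \<in> pverts G \<Longrightarrow> (f u, f v) \<in> parcs G \<longleftrightarrow> (u, v) \<in> parcs G"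
    by (auto simp: aut_group_def)
  have p': "inv_into UNIV f permutes pverts G"
    by (rule permutes_inv[OF p])
  have "(inv_into UNIV f u, inv_into UNIV f v) \<in> parcs G \<longleftrightarrow> (u, v) \<in> parcs G"
    if "u \<in> pverts G" "v \<in> pverts G" for u v
    using e[of "inv_into UNIV f u" "inv_into UNIV f v"] that
    by (simp only: permutes_in_image[OF p'] permutes_inverses(1)[OF p])
  then have "inv_into UNIV f \<in> carrier (aut_group G)"
    using p' by (simp add: aut_group_def)
  moreover have "inv_into UNIV f \<circ> f = id"
    using p by (simp add: permutes_inv_o)
  ultimately show "\<exists>g \<in> carrier (aut_group G). g \<otimes>\<^bsub>aut_group G\<^esub> f = \<one>\<^bsub>aut_group G\<^esub>"
    unfolding aut_group_def by (simp only: monoid.simps) (rule bexI)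
qed (simp_all add: aut_group_def permutes_compose permutes_id permutes_in_image comp_assoc)

definition o_v :: "'a pair_pre_digraph \<Rightarrow> nat" where
  "o_v G = card (orbits (aut_group G) (pverts G) (\<lambda>f u. f u))"

definition o_e :: "'a pair_pre_digraph \<Rightarrow> nat" where
  "o_e G = card (orbits (aut_group G) (edges G) (\<lambda>f e. f ` e))"

end

theory Submission
  imports Defs
begin

text \<open>
  Take a connected \<open>2s\<close>-regular graph and hang \<open>s\<close> cycles of length \<open>2m + 1\<close> (petals)
  at each vertex, where \<open>m\<close> is odd. Along a petal, a kernel vector is determined by its value \<open>x\<close> at
  the core vertex, and since \<open>2m + 1\<close> is 3 modulo 4 both petal neighbours of the core vertex carry
  \<open>-x\<close>. The equation at a core vertex then says that the sum over the \<open>2s\<close> core neighbours is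
  \<open>2s x\<close>, so the vector is constant on the core: the graph is a nut graph. Automorphisms preserve
  degrees, hence the core, hence the distance to the core; each petal has \<open>m\<close> orbits of vertices
  and \<open>m + 1\<close> orbits of edges under its reflection. For the core take the circulant graph on
  \<open>\<int>/n\<close> with steps \<open>\<plusminus>1, \<dots>, \<plusminus>e\<close> and \<open>n > 3e\<close>: it is vertex transitive, and an edge
  of step \<open>d\<close> lies in exactly \<open>2e - d - 1\<close> triangles, so it has exactly \<open>e\<close> edge orbits.
  With \<open>m = r - 1\<close> and \<open>e = k - r\<close> every \<open>n > 3e\<close> gives a graph as required.
\<close>

section \<open>Finite graphs and their encodings\<close>

text \<open>Connectedness is given by closed sets so that it applies directly to the set where a
  function is maximal and to the set reachable from a vertex.\<close>

locale finite_graph =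
  fixes V :: "'v set" and E :: "'v \<Rightarrow> 'v \<Rightarrow> bool"
  assumes finite_V: "finite V"
    and nonempty_V: "V \<noteq> {}"
    and E_in_V: "E u v \<Longrightarrow> u \<in> V"
    and E_sym: "E u v \<Longrightarrow> E v u"
    and E_irrefl: "\<not> E u u"
    and connected_V: "\<lbrakk>S \<subseteq> V; S \<noteq> {}; \<And>u v. u \<in> S \<Longrightarrow> E u v \<Longrightarrow> v \<in> S\<rbrakk> \<Longrightarrow> S = V"
begin

definition nbrs :: "'v \<Rightarrow> 'v set" where
  "nbrs v = {u. E v u}"

definition common_nbrs :: "'v \<Rightarrow> 'v \<Rightarrow> nat" where
  "common_nbrs u v = card (nbrs u \<inter> nbrs v)"

definition aut :: "('v \<Rightarrow> 'v) \<Rightarrow> bool" where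
  "aut f \<longleftrightarrow> bij_betw f V V \<and> (\<forall>u\<in>V. \<forall>v\<in>V. E (f u) (f v) \<longleftrightarrow> E u v)"

definition in_kernel :: "('v \<Rightarrow> real) \<Rightarrow> bool" where
  "in_kernel x \<longleftrightarrow> (\<forall>v\<in>V. sum x (nbrs v) = 0)"

lemma E_in_V2: "E u v \<Longrightarrow> v \<in> V"
  using E_sym E_in_V by blast

lemma nbrs_subset: "nbrs v \<subseteq> V"
  using E_in_V2 by (auto simp: nbrs_def)

lemma finite_nbrs: "finite (nbrs v)"
  using nbrs_subset finite_V by (rule finite_subset)

lemma common_nbrs_commute: "common_nbrs u v = common_nbrs v u"
  by (simp add: common_nbrs_def Int_commute)

lemma autI:
  assumes "\<And>v. v \<in> V \<Longrightarrow> f v \<in> V" "inj_on f V"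
    "\<And>u v. u \<in> V \<Longrightarrow> v \<in> V \<Longrightarrow> E (f u) (f v) \<longleftrightarrow> E u v"
  shows "aut f"
  unfolding aut_def bij_betw_def
  using assms endo_inj_surj[OF finite_V, of f] by blast

lemma aut_in_V: "aut f \<Longrightarrow> v \<in> V \<Longrightarrow> f v \<in> V"
  by (auto simp: aut_def dest: bij_betwE)

lemma aut_E: "aut f \<Longrightarrow> E u v \<Longrightarrow> E (f u) (f v)"
  by (metis E_in_V E_in_V2 aut_def)

lemma aut_inj: "aut f \<Longrightarrow> inj_on f V"
  by (simp add: aut_def bij_betw_def)

lemma aut_nbrs: "aut f \<Longrightarrow> v \<in> V \<Longrightarrow> nbrs (f v) = f ` nbrs v"
proof (intro equalityI subsetI)
  fix u assume f: "aut f" "v \<in> V" and u: "u \<in> nbrs (f v)"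
  then have "u \<in> f ` V" using nbrs_subset by (auto simp: aut_def bij_betw_def)
  then obtain w where "w \<in> V" "u = f w" by auto
  with f u show "u \<in> f ` nbrs v" by (auto simp: nbrs_def aut_def)
qed (auto simp: nbrs_def aut_E)

lemma aut_card_nbrs: "aut f \<Longrightarrow> v \<in> V \<Longrightarrow> card (nbrs (f v)) = card (nbrs v)"
  by (metis aut_nbrs aut_inj card_image inj_on_subset nbrs_subset)

lemma aut_common_nbrs:
  assumes "aut f" "u \<in> V" "v \<in> V"
  shows "common_nbrs (f u) (f v) = common_nbrs u v"
proof -
  have "nbrs (f u) \<inter> nbrs (f v) = f ` (nbrs u \<inter> nbrs v)"
    using assms by (simp add: aut_nbrs inj_on_image_Int[OF aut_inj nbrs_subset nbrs_subset])
  moreover have "inj_on f (nbrs u \<inter> nbrs v)"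
    using aut_inj[OF assms(1)] nbrs_subset by (blast intro: inj_on_subset)
  ultimately show ?thesis by (simp add: common_nbrs_def card_image)
qed

lemma aut_inv_into: "aut f \<Longrightarrow> aut (inv_into V f)"
proof -
  assume f: "aut f"
  then have b: "bij_betw f V V" by (simp add: aut_def)
  then have "E (inv_into V f u) (inv_into V f v) \<longleftrightarrow> E u v" if "u \<in> V" "v \<in> V" for u v
  proof -
    have "inv_into V f u \<in> V" "inv_into V f v \<in> V"
      using bij_betwE[OF bij_betw_inv_into[OF b]] that by auto
    then have "E (f (inv_into V f u)) (f (inv_into V f v)) \<longleftrightarrow> E (inv_into V f u) (inv_into V f v)"
      using f by (simp add: aut_def)
    then show ?thesis using b that by (simp add: bij_betw_inv_into_right)
  qed
  with b show ?thesis by (simp add: aut_def bij_betw_inv_into)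
qed

text \<open>Maximum principle: where \<open>x\<close> attains its maximum \<open>M\<close> it is a
  mean of values at most \<open>M\<close>, so all neighbours carry \<open>M\<close> too and the
  maximum set is closed under adjacency.\<close>

lemma harmonic_imp_constant:
  fixes x :: "'v \<Rightarrow> real"
  assumes harmonic: "\<And>v. v \<in> V \<Longrightarrow> sum x (nbrs v) = card (nbrs v) * x v"
  shows "\<exists>c. \<forall>v\<in>V. x v = c"
proof -
  define M where "M = Max (x ` V)"
  have le: "x v \<le> M" if "v \<in> V" for v
    using that finite_V by (simp add: M_def)
  have "{v \<in> V. x v = M} = V"
  proof (rule connected_V)
    have "M \<in> x ` V" using Max_in[of "x ` V"] finite_V nonempty_V by (simp add: M_def)
    then show "{v \<in> V. x v = M} \<noteq> {}" by auto
  next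
    fix u v assume u: "u \<in> {v \<in> V. x v = M}" and uv: "E u v"
    have "(\<Sum>w\<in>nbrs u. M - x w) = 0"
      using harmonic[of u] u by (simp add: sum_subtractf)
    moreover have "M - x w \<ge> 0" if "w \<in> nbrs u" for w
      using le that nbrs_subset by fastforce
    ultimately have "M - x v = 0"
      using uv sum_nonneg_eq_0_iff[OF finite_nbrs, of u "\<lambda>w. M - x w"] by (simp add: nbrs_def)
    then show "v \<in> {v \<in> V. x v = M}" using uv E_in_V2 by auto
  qed auto
  then show ?thesis by blast
qed

end

section \<open>Transport to graphs on natural numbers and the nut property\<close>

locale countable_graph = finite_graph V E
  for V :: "'v :: countable set" and E
begin

text \<open>\<open>adj_mat\<close> needs a linear order on the vertices, which structured vertices
  do not carry; \<open>to_nat\<close> also puts all graphs on one vertex type.\<close>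

definition encoding :: "nat pair_pre_digraph" where
  "encoding = \<lparr>pverts = to_nat ` V, parcs = {(to_nat u, to_nat v) | u v. E u v}\<rparr>"

lemma arc_encoding: "(to_nat u, to_nat v) \<in> parcs encoding \<longleftrightarrow> E u v"
  by (auto simp: encoding_def)

lemma card_pverts_encoding: "card (pverts encoding) = card V"
  by (simp add: encoding_def card_image)

lemma edges_encoding: "edges encoding = {to_nat ` {u, v} | u v. E u v}"
  by (fastforce simp: edges_def encoding_def)

lemma pair_graph_encoding: "pair_graph encoding"
proof
  show "finite (parcs encoding)"
    by (rule finite_subset[of _ "to_nat ` V \<times> to_nat ` V"])
      (auto simp: encoding_def finite_V E_in_V E_in_V2)
next
  show "symmetric (with_proj encoding)"
    by (auto simp: encoding_def symmetric_def intro!: symI dest: E_sym)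
next
  show "finite (pverts encoding)" by (simp add: encoding_def finite_V)
qed (auto simp: encoding_def E_in_V E_in_V2 E_irrefl)

text \<open>The vertices reachable from \<open>u\<close> form a nonempty closed set; symmetry of the
  arcs then turns strong connectedness into connectedness.\<close>

lemma connected_encoding: "Digraph_Component.connected (with_proj encoding)"
proof -
  interpret G: pair_graph encoding by (rule pair_graph_encoding)
  have "to_nat u \<rightarrow>\<^sup>*\<^bsub>with_proj encoding\<^esub> to_nat v" if "u \<in> V" "v \<in> V" for u v
  proof -
    let ?S = "{w \<in> V. to_nat u \<rightarrow>\<^sup>*\<^bsub>with_proj encoding\<^esub> to_nat w}"
    have "?S = V"
    proof (rule connected_V)
      have "to_nat u \<in> pverts encoding" using that by (simp add: encoding_def)
      then have "u \<in> ?S" using that by (simp add: G.reachable_refl)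
      then show "?S \<noteq> {}" by blast
    next
      fix w w' assume w: "w \<in> ?S" "E w w'"
      then have "(to_nat w, to_nat w') \<in> parcs encoding" by (simp add: arc_encoding)
      then show "w' \<in> ?S" using w E_in_V2 G.reachable_adj_trans by auto
    qed auto
    with that show ?thesis by auto
  qed
  then have "strongly_connected (with_proj encoding)"
    using nonempty_V by (auto simp: strongly_connected_def encoding_def)
  then show ?thesis
    using G.reachable_mk_symmetric_eq[OF G.pair_sym_arcs]
    by (simp add: connected_def strongly_connected_def)
qed

text \<open>Along the enumeration \<open>w\<close> of the vertices, vectors are functions on
  \<open>V\<close> and the adjacency matrix sums over neighbours, so its kernel corresponds to
  \<open>in_kernel\<close>.\<close>

lemma nut_graph_encoding:
  assumes y: "in_kernel y" "\<And>v. v \<in> V \<Longrightarrow> y v \<noteq> 0"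
    and unique: "\<And>x. in_kernel x \<Longrightarrow> \<exists>c. \<forall>v\<in>V. x v = c * y v"
  shows "nut_graph encoding"
proof -
  define n where "n = card V"
  define vs where "vs = sorted_list_of_set (pverts encoding)"
  define w where "w i = (from_nat (vs ! i) :: 'v)" for i
  have fin: "finite (pverts encoding)" by (simp add: encoding_def finite_V)
  have len: "length vs = n" by (simp add: vs_def n_def card_pverts_encoding)
  have nth: "bij_betw ((!) vs) {..<n} (to_nat ` V)"
    by (rule bij_betw_nth) (use fin len in \<open>simp_all add: vs_def encoding_def\<close>)
  have "bij_betw (from_nat :: nat \<Rightarrow> 'v) (to_nat ` V) V"
    by (rule bij_betwI[where g = to_nat]) auto
  from bij_betw_trans[OF nth this] have w: "bij_betw w {..<n} V"
    unfolding w_def by (simp add: comp_def)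
  have vs_w: "vs ! i = to_nat (w i)" if "i < n" for i
  proof -
    have "vs ! i \<in> to_nat ` V"
      using that bij_betwE[OF nth] by blast
    then show ?thesis by (auto simp: w_def)
  qed
  define A where "A = adj_mat encoding"
  have A: "A = mat n n (\<lambda>(i, j). if E (w i) (w j) then 1 else 0)"
    unfolding A_def adj_mat_def Let_def card_pverts_encoding
    by (rule eq_matI) (simp_all add: n_def[symmetric] vs_def[symmetric] vs_w arc_encoding)
  have Ac: "A \<in> carrier_mat n n" by (simp add: A)
  have row: "(A *\<^sub>v vec n (x \<circ> w)) $ i = sum x (nbrs (w i))" if "i < n" for i x
  proof -
    have "(A *\<^sub>v vec n (x \<circ> w)) $ i = (\<Sum>j<n. (if E (w i) (w j) then 1 else 0) * x (w j))"
      using that by (simp add: A scalar_prod_def atLeast0LessThan)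
    also have "\<dots> = (\<Sum>v\<in>V. (if E (w i) v then 1 else 0) * x v)"
      by (rule sum.reindex_bij_betw[OF w])
    also have "\<dots> = (\<Sum>v\<in>V. if v \<in> nbrs (w i) then x v else 0)"
      by (rule sum.cong) (auto simp: nbrs_def)
    also have "\<dots> = sum x (nbrs (w i))"
      using nbrs_subset[of "w i"] finite_V by (simp flip: sum.inter_restrict add: Int_absorb1)
    finally show ?thesis .
  qed
  have kernel_iff: "vec n (x \<circ> w) \<in> mat_kernel A \<longleftrightarrow> in_kernel x" for x
  proof -
    have "vec n (x \<circ> w) \<in> mat_kernel A \<longleftrightarrow> (\<forall>i<n. (A *\<^sub>v vec n (x \<circ> w)) $ i = 0)"
      by (auto simp: mat_kernel[OF Ac] Ac vec_eq_iff carrier_matD[OF Ac])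
    also have "\<dots> \<longleftrightarrow> (\<forall>i<n. sum x (nbrs (w i)) = 0)" by (simp add: row)
    also have "\<dots> \<longleftrightarrow> in_kernel x"
      using w by (auto simp: in_kernel_def bij_betw_def)
    finally show ?thesis .
  qed
  define k where "k = vec n (y \<circ> w)"
  have k: "k \<in> mat_kernel A" by (simp add: k_def kernel_iff y)
  have k_nz: "k $ i \<noteq> 0" if "i < n" for i
    using that y w by (auto simp: k_def dest: bij_betwE)
  have scale: "c \<cdot>\<^sub>v k \<in> mat_kernel A" for c
    by (rule mat_kernel_smult[OF Ac k])
  have multiple: "\<exists>c. z = c \<cdot>\<^sub>v k" if z: "z \<in> mat_kernel A" for z
  proof -
    define x where "x v = z $ inv_into {..<n} w v" for v
    have "z = vec n (x \<circ> w)"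
      using z mat_kernelD(1)[OF Ac z] w
      by (intro eq_vecI) (auto simp: x_def bij_betw_def)
    moreover from this z obtain c where "\<forall>v\<in>V. x v = c * y v"
      using kernel_iff unique by metis
    ultimately have "z = c \<cdot>\<^sub>v k"
      using w by (intro eq_vecI) (auto simp: k_def dest: bij_betwE)
    then show ?thesis ..
  qed
  have ker: "mat_kernel A = {c \<cdot>\<^sub>v k | c. True}"
    using scale multiple by auto
  interpret kernel n n A by (unfold_locales) (rule Ac)
  have "n > 0" using nonempty_V finite_V by (simp add: n_def card_gt_0_iff)
  then have k0: "k \<noteq> 0\<^sub>v n" using k_nz[of 0] by auto
  have k_sub: "{k} \<subseteq> mat_kernel A" using k by blast
  have k_carrier: "{k} \<subseteq> carrier_vec n" using mat_kernelD(1)[OF Ac k] by blast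
  \<comment> \<open>\<open>Ker.span\<close> is taken in the kernel as a space of its own;
    \<open>span_same\<close> exchanges it for the span in the ambient space.\<close>
  have "z \<in> Ker.span {k}" if z: "z \<in> mat_kernel A" for z
  proof -
    obtain c where c: "z = c \<cdot>\<^sub>v k" using multiple[OF z] by blast
    have "k \<in> NC.span {k}" using NC.in_own_span[OF k_carrier] by blast
    then show ?thesis
      unfolding c span_same[OF k_sub] by (rule NC.smult_in_span[OF k_carrier])
  qed
  then have gen: "Ker.span {k} = mat_kernel A"
    using Ker.span_is_subset2[OF k_sub] by (intro equalityI subsetI) auto
  have "kernel_dim A = 1"
    unfolding kernel_dim by (rule Ker.dim1I[OF gen k0 k])
  with ker k k_nz show ?thesis
    unfolding nut_graph_def A_def[symmetric] card_pverts_encoding n_def[symmetric]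
    using pair_graph_encoding connected_encoding by blast
qed

end

section \<open>Counting orbits by complete invariants\<close>

lemma card_orbits_eq_card_image:
  assumes "\<And>x y. x \<in> X \<Longrightarrow> y \<in> X \<Longrightarrow> y \<in> orbit G \<phi> x \<longleftrightarrow> c x = c y"
    and "\<And>x. x \<in> X \<Longrightarrow> orbit G \<phi> x \<subseteq> X"
  shows "card (orbits G X \<phi>) = card (c ` X)"
proof -
  \<comment> \<open>Each orbit is a full fibre of \<open>c\<close>, so orbits correspond to values
    of \<open>c\<close>.\<close>
  have "orbit G \<phi> x = {y \<in> X. c y = c x}" if "x \<in> X" for x
    using assms that by fastforce
  then have "orbits G X \<phi> = (\<lambda>k. {y \<in> X. c y = k}) ` c ` X"
    unfolding orbits_def Setcompr_eq_image image_image Collect_mem_eq by (intro image_cong refl)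
  moreover have "inj_on (\<lambda>k. {y \<in> X. c y = k}) (c ` X)"
    by (rule inj_onI) blast
  ultimately show ?thesis by (simp add: card_image)
qed

context countable_graph
begin

lemma aut_of_encoding:
  assumes "f \<in> carrier (aut_group encoding)"
  obtains g :: "'v \<Rightarrow> 'v" where "aut g" "\<And>v. v \<in> V \<Longrightarrow> f (to_nat v) = to_nat (g v)"
proof -
  have p: "f permutes (to_nat ` V)"
    and e: "\<And>u v. u \<in> V \<Longrightarrow> v \<in> V \<Longrightarrow>
      (f (to_nat u), f (to_nat v)) \<in> parcs encoding \<longleftrightarrow> (to_nat u, to_nat v) \<in> parcs encoding"
    using assms by (auto simp: aut_group_def encoding_def)
  define g where "g v = (from_nat (f (to_nat v)) :: 'v)" for v :: 'v
  have g: "f (to_nat v) = to_nat (g v)" if "v \<in> V" for v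
    using permutes_in_image[OF p, of "to_nat v"] that by (auto simp: g_def)
  have "bij_betw (to_nat :: 'v \<Rightarrow> nat) V (to_nat ` V)"
    by (simp add: inj_on_imp_bij_betw inj_on_def)
  moreover have "bij_betw (from_nat :: nat \<Rightarrow> 'v) (to_nat ` V) V"
    by (rule bij_betwI[where g = to_nat]) auto
  ultimately have "bij_betw g V V"
    unfolding g_def using bij_betw_trans[OF bij_betw_trans[OF _ permutes_imp_bij[OF p]]]
    by (force simp: comp_def)
  moreover have "E (g u) (g v) \<longleftrightarrow> E u v" if "u \<in> V" "v \<in> V" for u v
    using e[OF that] that by (simp add: g arc_encoding)
  ultimately have "aut g" by (auto simp: aut_def)
  then show thesis using g by (rule that)
qed

lemma encoding_of_aut:
  assumes "aut g"
  obtains f where "f \<in> carrier (aut_group encoding)" "\<And>v. v \<in> V \<Longrightarrow> f (to_nat v) = to_nat (g v)"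
proof -
  \<comment> \<open>Carrier elements must fix every number outside the encoded vertex set, hence the
    default value \<open>k\<close>.\<close>
  define f where "f k = (if k \<in> to_nat ` V then to_nat (g (from_nat k)) else k)" for k
  have f: "f (to_nat v) = to_nat (g v)" if "v \<in> V" for v
    using that by (simp add: f_def)
  have "bij_betw f (to_nat ` V) (to_nat ` V)"
  proof (rule bij_betw_imageI)
    show "inj_on f (to_nat ` V)"
      using aut_inj[OF assms] by (auto simp: inj_on_def f)
    have "f ` to_nat ` V = to_nat ` g ` V" by (force simp: f image_image)
    then show "f ` to_nat ` V = to_nat ` V"
      using assms by (simp add: aut_def bij_betw_def)
  qed
  then have "f permutes (to_nat ` V)"
    by (rule bij_imp_permutes) (simp add: f_def)
  moreover have "(f (to_nat u), f (to_nat v)) \<in> parcs encoding \<longleftrightarrow> (to_nat u, to_nat v) \<in> parcs encoding"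
    if "u \<in> V" "v \<in> V" for u v
    using assms that by (simp add: f arc_encoding aut_def)
  ultimately have "f \<in> carrier (aut_group encoding)"
    by (auto simp: aut_group_def encoding_def)
  with f that show thesis by blast
qed

text \<open>\<open>c\<close> is a complete invariant: \<open>inv\<close> makes it constant on
  orbits, and \<open>trans\<close> forbids two orbits with the same value.\<close>

lemma o_v_encoding:
  assumes inv: "\<And>f v. aut f \<Longrightarrow> v \<in> V \<Longrightarrow> c (f v) = c v"
    and trans: "\<And>u v. u \<in> V \<Longrightarrow> v \<in> V \<Longrightarrow> c u = c v \<Longrightarrow> \<exists>f. aut f \<and> f u = v"
  shows "o_v encoding = card (c ` V)"
proof -
  have 1: "to_nat v \<in> orbit (aut_group encoding) (\<lambda>f u. f u) (to_nat u) \<longleftrightarrow> c u = c v"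
    if uv: "u \<in> V" "v \<in> V" for u v
  proof
    assume "to_nat v \<in> orbit (aut_group encoding) (\<lambda>f u. f u) (to_nat u)"
    then obtain f where f: "f \<in> carrier (aut_group encoding)" "f (to_nat u) = to_nat v"
      by (auto simp: orbit_def)
    with uv show "c u = c v" by (auto elim!: aut_of_encoding simp: inv)
  next
    assume "c u = c v"
    then obtain g where g: "aut g" "g u = v" using trans uv by blast
    obtain f where "f \<in> carrier (aut_group encoding)" "f (to_nat u) = to_nat v"
      using encoding_of_aut[OF g(1)] g(2) uv by metis
    then show "to_nat v \<in> orbit (aut_group encoding) (\<lambda>f u. f u) (to_nat u)"
      unfolding orbit_def by (metis (mono_tags, lifting) mem_Collect_eq)
  qed
  have 2: "orbit (aut_group encoding) (\<lambda>f u. f u) (to_nat u) \<subseteq> to_nat ` V" if "u \<in> V" for u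
    using that by (auto simp: orbit_def elim!: aut_of_encoding intro: aut_in_V)
  have pverts: "pverts encoding = to_nat ` V" by (simp add: encoding_def)
  have "o_v encoding = card ((c \<circ> from_nat) ` pverts encoding)"
    unfolding o_v_def
  proof (rule card_orbits_eq_card_image)
    fix k l assume "k \<in> pverts encoding" "l \<in> pverts encoding"
    then show "l \<in> orbit (aut_group encoding) (\<lambda>f u. f u) k \<longleftrightarrow> (c \<circ> from_nat) k = (c \<circ> from_nat) l"
      using 1 by (auto simp: pverts)
  next
    fix k assume "k \<in> pverts encoding"
    then show "orbit (aut_group encoding) (\<lambda>f u. f u) k \<subseteq> pverts encoding"
      using 2 unfolding pverts by blast
  qed
  then show ?thesis by (simp add: encoding_def image_image)
qed

lemma o_e_encoding:
  assumes sym: "\<And>u v. c u v = c v u"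
    and inv: "\<And>f u v. aut f \<Longrightarrow> E u v \<Longrightarrow> c (f u) (f v) = c u v"
    and trans: "\<And>u v u' v'. E u v \<Longrightarrow> E u' v' \<Longrightarrow> c u v = c u' v' \<Longrightarrow>
      \<exists>f. aut f \<and> {f u, f v} = {u', v'}"
  shows "o_e encoding = card {c u v | u v. E u v}"
proof -
  \<comment> \<open>\<open>d\<close> is the function on edges induced by \<open>c\<close>; on
    encoded pairs the description is unique because \<open>c\<close> is symmetric.\<close>
  define d where "d e = (THE k. \<exists>u v. e = to_nat ` {u, v} \<and> k = c u v)" for e
  have pair: "{a, b} = {u, v} \<Longrightarrow> c a b = c u v" for a b u v
    using sym by (auto simp: doubleton_eq_iff)
  have d: "d {to_nat u, to_nat v} = c u v" for u v
    unfolding d_def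
  proof (rule the_equality)
    fix k assume "\<exists>a b. {to_nat u, to_nat v} = to_nat ` {a, b} \<and> k = c a b"
    then obtain a b where "{to_nat u, to_nat v} = to_nat ` {a, b}" "k = c a b" by blast
    then show "k = c u v" using sym by (auto simp: doubleton_eq_iff)
  qed auto
  have edge: "{to_nat u, to_nat v} \<in> edges encoding" if "E u v" for u v
    using that by (auto simp: edges_encoding)
  have edgeE: "\<exists>u v. e = {to_nat u, to_nat v} \<and> E u v" if "e \<in> edges encoding" for e
    using that by (auto simp: edges_encoding)
  have 1: "{to_nat u', to_nat v'} \<in> orbit (aut_group encoding) (\<lambda>f e. f ` e) {to_nat u, to_nat v}
      \<longleftrightarrow> c u v = c u' v'"
    if uv: "E u v" "E u' v'" for u v u' v'
  proof
    assume "{to_nat u', to_nat v'} \<in> orbit (aut_group encoding) (\<lambda>f e. f ` e) {to_nat u, to_nat v}"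
    then obtain f where f: "f \<in> carrier (aut_group encoding)"
        "{to_nat u', to_nat v'} = {f (to_nat u), f (to_nat v)}"
      by (auto simp: orbit_def)
    obtain g where g: "aut g" "\<And>v. v \<in> V \<Longrightarrow> f (to_nat v) = to_nat (g v)"
      using aut_of_encoding[OF f(1)] by blast
    have "{u', v'} = {g u, g v}"
      using f(2) g(2)[OF E_in_V[OF uv(1)]] g(2)[OF E_in_V2[OF uv(1)]]
      by (simp add: doubleton_eq_iff)
    then have "c u' v' = c (g u) (g v)" by (rule pair)
    also have "\<dots> = c u v" by (rule inv[OF g(1) uv(1)])
    finally show "c u v = c u' v'" by simp
  next
    assume "c u v = c u' v'"
    then obtain g where g: "aut g" "{g u, g v} = {u', v'}" using trans uv by blast
    obtain f where f: "f \<in> carrier (aut_group encoding)"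
        "\<And>v. v \<in> V \<Longrightarrow> f (to_nat v) = to_nat (g v)"
      using encoding_of_aut[OF g(1)] by blast
    have "f ` {to_nat u, to_nat v} = to_nat ` {g u, g v}"
      using f(2) E_in_V[OF uv(1)] E_in_V2[OF uv(1)] by simp
    then have "f ` {to_nat u, to_nat v} = {to_nat u', to_nat v'}"
      by (simp only: g(2) image_insert image_empty)
    with f(1) show "{to_nat u', to_nat v'} \<in> orbit (aut_group encoding) (\<lambda>f e. f ` e) {to_nat u, to_nat v}"
      unfolding orbit_def by blast
  qed
  have 2: "orbit (aut_group encoding) (\<lambda>f e. f ` e) {to_nat u, to_nat v} \<subseteq> edges encoding"
    if "E u v" for u v
  proof
    fix e assume "e \<in> orbit (aut_group encoding) (\<lambda>f e. f ` e) {to_nat u, to_nat v}"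
    then obtain f where f: "f \<in> carrier (aut_group encoding)" "e = {f (to_nat u), f (to_nat v)}"
      by (auto simp: orbit_def)
    obtain g where g: "aut g" "\<And>v. v \<in> V \<Longrightarrow> f (to_nat v) = to_nat (g v)"
      using aut_of_encoding[OF f(1)] by blast
    have "e = {to_nat (g u), to_nat (g v)}"
      using f(2) g(2)[OF E_in_V[OF that]] g(2)[OF E_in_V2[OF that]] by simp
    then show "e \<in> edges encoding" using edge aut_E[OF g(1) that] by simp
  qed
  have "o_e encoding = card (d ` edges encoding)"
    unfolding o_e_def
  proof (rule card_orbits_eq_card_image)
    fix e e' assume "e \<in> edges encoding" "e' \<in> edges encoding"
    then show "e' \<in> orbit (aut_group encoding) (\<lambda>f e. f ` e) e \<longleftrightarrow> d e = d e'"
      using 1 d by (auto dest!: edgeE)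
  next
    fix e assume "e \<in> edges encoding"
    then show "orbit (aut_group encoding) (\<lambda>f e. f ` e) e \<subseteq> edges encoding"
      using 2 by (auto dest!: edgeE)
  qed
  also have "d ` edges encoding = {c u v | u v. E u v}"
    unfolding edges_encoding by (auto simp: d image_iff) (metis d)+
  finally show ?thesis .
qed

end

text \<open>The vertex count is the invariant that later separates the graphs built from cores of
  different sizes.\<close>

lemma digraph_iso_card_pverts:
  assumes "digraph_iso (with_proj G) (with_proj H)"
  shows "card (pverts G) = card (pverts H)"
proof -
  obtain h where h: "pre_digraph.digraph_isomorphism (with_proj G) h"
      "with_proj H = app_iso h (with_proj G)"
    using assms by (auto simp: digraph_iso_def)
  from h(2) have "verts (with_proj H) = iso_verts h ` verts (with_proj G)"
    by (simp add: verts_app_iso)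
  moreover have "inj_on (iso_verts h) (pverts G)"
    using h(1) by (simp add: pre_digraph.digraph_isomorphism_def)
  ultimately show ?thesis by (simp add: card_image)
qed

section \<open>Attaching petals to a regular graph\<close>

text \<open>
  \<open>Petal i t b l\<close> lies on the \<open>t\<close>-th cycle at \<open>i\<close>, on the half of it selected by \<open>b\<close>, at
  distance \<open>l\<close> from the core; the two halves are joined at \<open>l = m\<close>.
\<close>

datatype 'w flower = Core 'w | Petal 'w nat bool nat

instance flower :: (countable) countable
  by countable_datatype

fun level :: "'w flower \<Rightarrow> nat" where
  "level (Core i) = 0"
| "level (Petal i t b l) = l"

text \<open>The core degree \<open>2 * s\<close> matches the number of petal neighbours of a core
  vertex, which balances the kernel equation there.\<close>

locale flower_graph = base: finite_graph W A
  for W :: "'w :: countable set" and A :: "'w \<Rightarrow> 'w \<Rightarrow> bool" +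
  fixes s m :: nat
  assumes regular: "i \<in> W \<Longrightarrow> card (base.nbrs i) = 2 * s"
    and s_pos: "s > 0"
    and odd_m: "odd m"
begin

text \<open>
  The edges outside the core are exactly the pairs \<open>stem i t b l\<close>, \<open>succ i t b l\<close> with \<open>l \<le> m\<close>,
  the case \<open>l = m\<close> being the edge opposite to the core vertex.
\<close>

definition stem :: "'w \<Rightarrow> nat \<Rightarrow> bool \<Rightarrow> nat \<Rightarrow> 'w flower" where
  "stem i t b l = (if l = 0 then Core i else Petal i t b l)"

definition succ :: "'w \<Rightarrow> nat \<Rightarrow> bool \<Rightarrow> nat \<Rightarrow> 'w flower" where
  "succ i t b l = (if l < m then Petal i t b (Suc l) else Petal i t (\<not> b) m)"

fun flower_vert :: "'w flower \<Rightarrow> bool" where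
  "flower_vert (Core i) \<longleftrightarrow> i \<in> W"
| "flower_vert (Petal i t b l) \<longleftrightarrow> i \<in> W \<and> t < s \<and> 0 < l \<and> l \<le> m"

fun flower_adj :: "'w flower \<Rightarrow> 'w flower \<Rightarrow> bool" where
  "flower_adj (Core i) (Core j) \<longleftrightarrow> A i j"
| "flower_adj (Core i) (Petal j t b l) \<longleftrightarrow> i \<in> W \<and> t < s \<and> i = j \<and> l = 1"
| "flower_adj (Petal j t b l) (Core i) \<longleftrightarrow> i \<in> W \<and> t < s \<and> i = j \<and> l = 1"
| "flower_adj (Petal i t b l) (Petal j t' b' l') \<longleftrightarrow> i \<in> W \<and> t < s \<and> i = j \<and> t = t' \<and>
     0 < l \<and> l \<le> m \<and> 0 < l' \<and> l' \<le> m \<and>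
     (if b = b' then l' = Suc l \<or> l = Suc l' else l = m \<and> l' = m)"

lemma m_pos: "m > 0"
  using odd_m by (simp add: odd_pos)

lemma flower_adj_in_flower_vert: "flower_adj u v \<Longrightarrow> flower_vert u"
  using m_pos base.E_in_V by (cases u; cases v) auto

lemma flower_adj_sym: "flower_adj u v \<Longrightarrow> flower_adj v u"
  using base.E_sym by (cases u; cases v) (auto split: if_splits)

lemma level_stem [simp]: "level (stem i t b l) = l"
  by (simp add: stem_def)

lemma flower_vert_stem [simp]: "t < s \<Longrightarrow> flower_vert (stem i t b l) \<longleftrightarrow> i \<in> W \<and> l \<le> m"
  by (simp add: stem_def)

lemma flower_adj_stem_succ: "i \<in> W \<Longrightarrow> t < s \<Longrightarrow> l \<le> m \<Longrightarrow> flower_adj (stem i t b l) (succ i t b l)"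
  using m_pos by (auto simp: stem_def succ_def)

lemma stem_cases:
  assumes "flower_vert v"
  obtains i t b l where "v = stem i t b l" "i \<in> W" "t < s" "l \<le> m"
proof (cases v)
  case (Core i)
  \<comment> \<open>A core vertex is level 0 of each of its petals; petal 0 exists by
    \<open>s_pos\<close>, and the half is arbitrary.\<close>
  with assms that[of i 0 False 0] s_pos show thesis by (simp add: stem_def)
next
  case (Petal i t b l)
  with assms that[of i t b l] show thesis by (simp add: stem_def)
qed

text \<open>Unordered pairs let the edges at the core, along a half and opposite to the core be
  treated as one family indexed by \<open>l \<le> m\<close>.\<close>

lemma flower_adj_cases:
  assumes "flower_adj u v"
  obtains (core) i j where "u = Core i" "v = Core j" "A i j"
  | (petal) i t b l where "{u, v} = {stem i t b l, succ i t b l}" "i \<in> W" "t < s" "l \<le> m"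
proof -
  show thesis
  proof (cases u)
    case u: (Core i)
    show thesis
    proof (cases v)
      case (Core j)
      with u assms core show thesis by simp
    next
      case (Petal j t b l)
      with u assms m_pos show thesis by (intro petal[of i t b 0]) (auto simp: stem_def succ_def)
    qed
  next
    case u: (Petal i t b l)
    show thesis
    proof (cases v)
      case (Core j)
      with u assms m_pos show thesis by (intro petal[of i t b 0]) (auto simp: stem_def succ_def)
    next
      case v: (Petal j t' b' l')
      consider "b' = b" "l' = Suc l" | "b' = b" "l = Suc l'" | "b' = (\<not> b)" "l = m" "l' = m"
        using assms u v by (auto split: if_splits)
      then show thesis
      proof cases
        case 1
        with u v assms show thesis by (intro petal[of i t b l]) (auto simp: stem_def succ_def)
      next
        case 2
        with u v assms show thesis by (intro petal[of i t b l']) (auto simp: stem_def succ_def)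
      next
        case 3
        with u v assms show thesis by (intro petal[of i t b m]) (auto simp: stem_def succ_def)
      qed
    qed
  qed
qed

lemma level_succ: "level (succ i t b l) = (if l < m then Suc l else m)"
  by (simp add: succ_def)

lemma flower_vert_eq:
  "{v. flower_vert v} = Core ` W \<union> (\<lambda>(i, t, b, l). Petal i t b l) ` (W \<times> {..<s} \<times> UNIV \<times> {1..m})"
  by (auto elim!: flower_vert.elims simp: image_iff)

lemma finite_flower_vert: "finite {v. flower_vert v}"
  unfolding flower_vert_eq using base.finite_V by auto

lemma card_flower_vert: "card {v. flower_vert v} = card W * (1 + 2 * s * m)"
proof -
  have "card {v. flower_vert v} = card (Core ` W) +
      card ((\<lambda>(i, t, b, l). Petal i t b l) ` (W \<times> {..<s} \<times> (UNIV :: bool set) \<times> {1..m}))"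
    unfolding flower_vert_eq using base.finite_V by (intro card_Un_disjoint) auto
  also have "\<dots> = card W + card (W \<times> {..<s} \<times> (UNIV :: bool set) \<times> {1..m})"
    by (subst (1 2) card_image) (auto simp: inj_on_def)
  also have "\<dots> = card W * (1 + 2 * s * m)"
    by (simp add: card_cartesian_product algebra_simps)
  finally show ?thesis .
qed

text \<open>For connectedness, a closed set is followed down a petal to the core, spread over the
  core by connectedness of the base graph, and followed up every petal.\<close>

sublocale countable_graph "{v. flower_vert v}" flower_adj
proof
  show "{v. flower_vert v} \<noteq> {}"
    using base.nonempty_V flower_vert.simps(1) by blast
  show "\<not> flower_adj u u" for u
    using base.E_irrefl by (cases u) auto
next
  fix S assume S: "S \<subseteq> {v. flower_vert v}" "S \<noteq> {}"
    and closed: "\<And>u v. u \<in> S \<Longrightarrow> flower_adj u v \<Longrightarrow> v \<in> S"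
  have down: "Core i \<in> S" if "stem i t b l \<in> S" "i \<in> W" "t < s" "l \<le> m" for i t b l
    using that
  proof (induction l)
    case (Suc l)
    have "flower_adj (stem i t b (Suc l)) (stem i t b l)"
      using flower_adj_sym[OF flower_adj_stem_succ[of i t l b]] Suc.prems by (simp add: stem_def succ_def)
    with Suc show ?case by (simp add: closed)
  qed (simp add: stem_def)
  have up: "stem i t b l \<in> S" if "Core i \<in> S" "i \<in> W" "t < s" "l \<le> m" for i t b l
    using that
  proof (induction l)
    case (Suc l)
    have "flower_adj (stem i t b l) (stem i t b (Suc l))"
      using flower_adj_stem_succ[of i t l b] Suc.prems by (simp add: stem_def succ_def)
    with Suc show ?case by (simp add: closed)
  qed (simp add: stem_def)
  have "{i \<in> W. Core i \<in> S} = W"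
  proof (rule base.connected_V)
    obtain v where "v \<in> S" using S by blast
    with S have "flower_vert v" by blast
    with \<open>v \<in> S\<close> down show "{i \<in> W. Core i \<in> S} \<noteq> {}" by (auto elim!: stem_cases)
  next
    fix i j assume "i \<in> {i \<in> W. Core i \<in> S}" "A i j"
    then show "j \<in> {i \<in> W. Core i \<in> S}"
      using closed[of "Core i" "Core j"] base.E_in_V2 by simp
  qed auto
  then have "v \<in> S" if flower_vert: "flower_vert v" for v
  proof -
    obtain i t b l where v: "v = stem i t b l" "i \<in> W" "t < s" "l \<le> m"
      using stem_cases[OF flower_vert] by blast
    with \<open>{i \<in> W. Core i \<in> S} = W\<close> have "Core i \<in> S" by blast
    with v up show ?thesis by simp
  qed
  with S show "S = {v. flower_vert v}" by blast
qed (use finite_flower_vert flower_adj_in_flower_vert flower_adj_sym in auto)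

lemma nbrs_Core:
  assumes "i \<in> W"
  shows "nbrs (Core i) = Core ` base.nbrs i \<union> (\<lambda>(t, b). Petal i t b 1) ` ({..<s} \<times> UNIV)"
proof (rule Set.set_eqI)
  fix v show "v \<in> nbrs (Core i) \<longleftrightarrow>
      v \<in> Core ` base.nbrs i \<union> (\<lambda>(t, b). Petal i t b 1) ` ({..<s} \<times> UNIV)"
    using assms by (cases v) (auto simp: nbrs_def base.nbrs_def image_iff)
qed

lemma nbrs_Petal:
  assumes "i \<in> W" "t < s" "0 < l" "l \<le> m"
  shows "nbrs (Petal i t b l) = {stem i t b (l - 1), succ i t b l}"
proof (rule Set.set_eqI)
  fix v show "v \<in> nbrs (Petal i t b l) \<longleftrightarrow> v \<in> {stem i t b (l - 1), succ i t b l}"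
    using assms by (cases v) (auto simp: nbrs_def stem_def succ_def)
qed

lemma sum_nbrs_Core:
  fixes x :: "'w flower \<Rightarrow> real"
  assumes "i \<in> W"
  shows "sum x (nbrs (Core i)) =
    (\<Sum>j\<in>base.nbrs i. x (Core j)) + (\<Sum>t<s. \<Sum>b\<in>UNIV. x (Petal i t b 1))"
proof -
  let ?P = "(\<lambda>(t, b). Petal i t b 1) ` ({..<s} \<times> (UNIV :: bool set))"
  have "sum x (nbrs (Core i)) = sum x (Core ` base.nbrs i) + sum x ?P"
    unfolding nbrs_Core[OF assms] using base.finite_nbrs by (intro sum.union_disjoint) auto
  also have "sum x (Core ` base.nbrs i) = (\<Sum>j\<in>base.nbrs i. x (Core j))"
    by (subst sum.reindex) (auto simp: inj_on_def)
  also have "sum x ?P = (\<Sum>(t, b)\<in>{..<s} \<times> UNIV. x (Petal i t b 1))"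
    by (subst sum.reindex) (auto simp: inj_on_def intro!: sum.cong)
  also have "\<dots> = (\<Sum>t<s. \<Sum>b\<in>UNIV. x (Petal i t b 1))"
    by (simp add: sum.cartesian_product)
  finally show ?thesis .
qed

lemma sum_nbrs_Petal:
  fixes x :: "'w flower \<Rightarrow> real"
  assumes "i \<in> W" "t < s" "0 < l" "l \<le> m"
  shows "sum x (nbrs (Petal i t b l)) = x (stem i t b (l - 1)) + x (succ i t b l)"
proof -
  \<comment> \<open>One neighbour is on a level below \<open>l\<close>, the other is not, so the sum
    really has two terms.\<close>
  have "stem i t b (l - 1) \<noteq> succ i t b l" using assms by (auto simp: stem_def succ_def)
  with assms show ?thesis by (simp add: nbrs_Petal)
qed

lemma card_nbrs_Core:
  assumes "i \<in> W"
  shows "card (nbrs (Core i)) = 4 * s"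
  \<comment> \<open>The degree is the neighbour sum of the constant function 1.\<close>
  using sum_nbrs_Core[OF assms, of "\<lambda>_. 1"] regular[OF assms] by (simp flip: of_nat_eq_iff[where 'a = real])

lemma card_nbrs_Petal:
  assumes "flower_vert (Petal i t b l)"
  shows "card (nbrs (Petal i t b l)) = 2"
  using assms nbrs_Petal[of i t l b] by (auto simp: stem_def succ_def card_insert_if)

end

section \<open>The kernel of the flower graph\<close>

definition petal_sign :: "nat \<Rightarrow> real" where
  "petal_sign l = (- 1) ^ ((l + 1) div 2)"

text \<open>The signs run +, -, -, + with period 4; the recursion is the kernel equation at the
  level in between.\<close>

lemma petal_sign_simps [simp]:
  "petal_sign 0 = 1" "petal_sign (Suc 0) = - 1"
  "petal_sign (Suc (Suc l)) = - petal_sign l"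
  by (simp_all add: petal_sign_def)

lemma petal_sign_nonzero: "petal_sign l \<noteq> 0"
  by (simp add: petal_sign_def)

text \<open>Gives the kernel equation at level \<open>m\<close>, where the outer neighbour is again
  on level \<open>m\<close>, in the other half.\<close>

lemma petal_sign_odd: "odd l \<Longrightarrow> petal_sign l = - petal_sign (l - 1)"
  by (auto simp: petal_sign_def elim!: oddE)

context flower_graph
begin

lemma in_kernel_petal_sign: "in_kernel (petal_sign \<circ> level)"
  unfolding in_kernel_def
proof
  fix v assume v: "v \<in> {v. flower_vert v}"
  show "sum (petal_sign \<circ> level) (nbrs v) = 0"
  proof (cases v)
    case (Core i)
    with v have "i \<in> W" by simp
    then show ?thesis by (simp add: Core sum_nbrs_Core regular UNIV_bool)
  next
    case (Petal i t b l)
    with v have l: "i \<in> W" "t < s" "0 < l" "l \<le> m" by auto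
    have "petal_sign (l - 1) + petal_sign (level (succ i t b l)) = 0"
    proof (cases "l < m")
      case True
      with l show ?thesis by (cases l) (simp_all add: level_succ)
    next
      case False
      with l odd_m show ?thesis by (simp add: level_succ petal_sign_odd)
    qed
    with l show ?thesis by (simp add: Petal sum_nbrs_Petal)
  qed
qed

text \<open>Moving two levels along a half flips the sign, so the values at levels 0 and 1 determine
  the half. The equation at the tip of the opposite half then fixes the value at level 1.\<close>

lemma in_kernel_stem:
  assumes x: "in_kernel x" and i: "i \<in> W" and t: "t < s" and l: "l \<le> m"
  shows "x (stem i t b l) = petal_sign l * x (Core i)"
proof -
  have eq: "x (stem i t b (l - 1)) + x (succ i t b l) = 0" if "0 < l" "l \<le> m" for b l
  proof -
    have "sum x (nbrs (Petal i t b l)) = 0"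
      using x i t that by (simp add: in_kernel_def)
    then show ?thesis by (simp add: sum_nbrs_Petal i t that)
  qed
  \<comment> \<open>For odd \<open>l\<close> the recursion starts at level 1, where
    \<open>petal_sign\<close> is -1; the minus sign compensates for this.\<close>
  have two_step: "x (stem i t b l) =
      petal_sign l * (if even l then x (Core i) else - x (stem i t b 1))" if "l \<le> m" for b l
    using that
  proof (induction l rule: induct_nat_012)
    case (ge2 l)
    have "x (stem i t b l) + x (stem i t b (Suc (Suc l))) = 0"
      using eq[of "Suc l" b] ge2.prems by (simp add: stem_def succ_def)
    with ge2 show ?case by simp
  qed (simp_all add: stem_def)
  have first: "x (stem i t b (Suc 0)) = - x (Core i)" for b
  proof -
    \<comment> \<open>The outer neighbour of the tip of half \<open>\<not> b\<close> is the tip of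
      half \<open>b\<close>. As \<open>m - 1\<close> is even and \<open>m\<close> odd, this compares
      the core value with the level 1 value of half \<open>b\<close>.\<close>
    have "x (stem i t (\<not> b) (m - 1)) + x (stem i t b m) = 0"
      using eq[of m "\<not> b"] m_pos by (simp add: stem_def succ_def)
    then have "petal_sign (m - 1) * (x (Core i) + x (stem i t b 1)) = 0"
      using two_step[of "m - 1" "\<not> b"] two_step[of m b] odd_m
      by (simp add: petal_sign_odd algebra_simps)
    then show ?thesis by (simp add: petal_sign_nonzero)
  qed
  show ?thesis using two_step[OF l, of b] by (simp add: first)
qed

text \<open>The petals contribute \<open>- 2 * s * x (Core i)\<close> at \<open>Core i\<close>, so
  the core values are harmonic, hence constant, and they determine the rest.\<close>

lemma in_kernel_unique:
  assumes x: "in_kernel x"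
  shows "\<exists>c. \<forall>v\<in>{v. flower_vert v}. x v = c * (petal_sign \<circ> level) v"
proof -
  have "\<exists>c. \<forall>i\<in>W. x (Core i) = c"
  proof (rule base.harmonic_imp_constant)
    fix i assume i: "i \<in> W"
    have petal: "x (Petal i t b 1) = - x (Core i)" if "t < s" for t b
      using in_kernel_stem[OF x i that, of 1 b] m_pos by (simp add: stem_def)
    have "0 = sum x (nbrs (Core i))"
      using x i by (simp add: in_kernel_def)
    also have "\<dots> = (\<Sum>j\<in>base.nbrs i. x (Core j)) - 2 * real s * x (Core i)"
      unfolding sum_nbrs_Core[OF i] UNIV_bool using petal by simp
    finally show "(\<Sum>j\<in>base.nbrs i. x (Core j)) = card (base.nbrs i) * x (Core i)"
      by (simp add: regular[OF i])
  qed
  then obtain c where c: "\<And>i. i \<in> W \<Longrightarrow> x (Core i) = c" by blast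
  have "x v = c * petal_sign (level v)" if flower_vert: "flower_vert v" for v
  proof -
    obtain i t b l where v: "v = stem i t b l" "i \<in> W" "t < s" "l \<le> m"
      using stem_cases[OF flower_vert] by blast
    show ?thesis using in_kernel_stem[OF x v(2-4), of b] c v by simp
  qed
  then show ?thesis by auto
qed

lemma nut_graph_flower: "nut_graph encoding"
  by (rule nut_graph_encoding[OF in_kernel_petal_sign _ in_kernel_unique])
    (simp_all add: petal_sign_nonzero)

section \<open>Automorphisms of the flower graph\<close>

lemma level_le_m: "flower_vert v \<Longrightarrow> level v \<le> m"
  by (cases v) auto

lemma flower_adj_level: "flower_adj u v \<Longrightarrow> level v \<le> Suc (level u)"
  by (cases u; cases v) (auto split: if_splits)

text \<open>Petal vertices have degree 2 and core vertices \<open>4 * s\<close>, so the core is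
  recognised by degrees.\<close>

lemma level_0_iff_degree:
  assumes "flower_vert v"
  shows "level v = 0 \<longleftrightarrow> card (nbrs v) \<noteq> 2"
proof (cases v)
  case (Core i)
  with assms s_pos show ?thesis by (auto simp: card_nbrs_Core)
next
  case (Petal i t b l)
  with assms show ?thesis using card_nbrs_Petal by auto
qed

lemma aut_flower_vert: "aut f \<Longrightarrow> flower_vert v \<Longrightarrow> flower_vert (f v)"
  using aut_in_V by auto

text \<open>Induction along a petal: degrees keep level 0 fixed, and an edge raises the level by at
  most one. The inverse automorphism later gives the other inequality.\<close>

lemma level_aut_le:
  assumes f: "aut f" and "flower_vert v"
  shows "level (f v) \<le> level v"
proof -
  obtain i t b l where v: "v = stem i t b l" "i \<in> W" "t < s" "l \<le> m"
    using stem_cases[OF assms(2)] by blast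
  have "level (f (stem i t b l)) \<le> l"
    using v(4)
  proof (induction l)
    case 0
    have "flower_vert (stem i t b 0)" using v by simp
    then show ?case
      using level_0_iff_degree[of "stem i t b 0"] level_0_iff_degree[of "f (stem i t b 0)"]
        aut_flower_vert[OF f] aut_card_nbrs[OF f] by simp
  next
    case (Suc l)
    have "flower_adj (stem i t b l) (stem i t b (Suc l))"
      using flower_adj_stem_succ[OF v(2,3), of l b] Suc.prems by (simp add: stem_def succ_def)
    then have "level (f (stem i t b (Suc l))) \<le> Suc (level (f (stem i t b l)))"
      by (intro flower_adj_level aut_E[OF f])
    with Suc show ?case by simp
  qed
  with v show ?thesis by simp
qed

lemma level_aut:
  assumes f: "aut f" and v: "flower_vert v"
  shows "level (f v) = level v"
proof (rule antisym[OF level_aut_le[OF f v]])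
  have "inv_into {v. flower_vert v} f (f v) = v"
    using v by (intro inv_into_f_f[OF aut_inj[OF f]]) simp
  then show "level v \<le> level (f v)"
    using level_aut_le[OF aut_inv_into[OF f] aut_flower_vert[OF f v]] by simp
qed

text \<open>\<open>g\<close> moves the core, \<open>p\<close> permutes the petals at every vertex,
  and \<open>c = True\<close> reflects all petals at once: \<open>b \<noteq> c\<close> is exclusive
  or.\<close>

fun lift :: "('w \<Rightarrow> 'w) \<Rightarrow> (nat \<Rightarrow> nat) \<Rightarrow> bool \<Rightarrow> 'w flower \<Rightarrow> 'w flower" where
  "lift g p c (Core i) = Core (g i)"
| "lift g p c (Petal i t b l) = Petal (g i) (p t) (b \<noteq> c) l"

lemma aut_lift:
  assumes g: "base.aut g" and p: "p permutes {..<s}"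
  shows "aut (lift g p c)"
proof (rule autI)
  have g_inj: "g i = g j \<longleftrightarrow> i = j" if "i \<in> W" "j \<in> W" for i j
    using base.aut_inj[OF g] that by (auto simp: inj_on_def)
  have g_W: "g i \<in> W" if "i \<in> W" for i using base.aut_in_V[OF g that] .
  have p_s: "p t < s \<longleftrightarrow> t < s" for t using permutes_in_image[OF p] by auto
  have p_inj: "p t = p t' \<longleftrightarrow> t = t'" for t t' using permutes_inj[OF p] by (auto simp: inj_def)
  show "lift g p c v \<in> {v. flower_vert v}" if "v \<in> {v. flower_vert v}" for v
    using that by (cases v) (auto simp: g_W p_s)
  show "inj_on (lift g p c) {v. flower_vert v}"
  proof (rule inj_onI)
    fix u v assume "u \<in> {v. flower_vert v}" "v \<in> {v. flower_vert v}" "lift g p c u = lift g p c v"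
    then show "u = v" by (cases u; cases v) (auto simp: g_inj p_inj)
  qed
  show "flower_adj (lift g p c u) (lift g p c v) \<longleftrightarrow> flower_adj u v"
    if "u \<in> {v. flower_vert v}" "v \<in> {v. flower_vert v}" for u v
    using that g by (cases u; cases v) (auto simp: g_W g_inj p_s p_inj base.aut_def)
qed

lemma lift_stem: "lift g p c (stem i t b l) = stem (g i) (p t) (b \<noteq> c) l"
  by (simp add: stem_def)

lemma lift_succ: "lift g p c (succ i t b l) = succ (g i) (p t) (b \<noteq> c) l"
  by (auto simp: succ_def)

text \<open>Petals at distinct core vertices are disjoint, so every triangle on a core edge stays in
  the core.\<close>

lemma common_nbrs_Core:
  assumes "A i j"
  shows "common_nbrs (Core i) (Core j) = base.common_nbrs i j"
proof -
  have ij: "i \<in> W" "j \<in> W" "i \<noteq> j"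
    using assms base.E_in_V base.E_in_V2 base.E_irrefl by auto
  then have "nbrs (Core i) \<inter> nbrs (Core j) = Core ` (base.nbrs i \<inter> base.nbrs j)"
    by (auto simp: nbrs_Core)
  then show ?thesis
    by (simp add: common_nbrs_def base.common_nbrs_def card_image inj_on_def)
qed

end

section \<open>Vertex and edge orbits of the flower graph\<close>

locale transitive_flower_graph = flower_graph +
  assumes vertex_transitive: "i \<in> W \<Longrightarrow> j \<in> W \<Longrightarrow> \<exists>g. base.aut g \<and> g i = j"
    and edge_transitive: "A i j \<Longrightarrow> A i' j' \<Longrightarrow> base.common_nbrs i j = base.common_nbrs i' j' \<Longrightarrow>
      \<exists>g. base.aut g \<and> {g i, g j} = {i', j'}"
begin

text \<open>Combines a core automorphism, a transposition of petal indices and, if \<open>b\<close>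
  and \<open>b'\<close> differ, the reflection. One \<open>f\<close> works for all levels, hence for
  vertices and petal edges alike.\<close>

lemma aut_stem:
  assumes "i \<in> W" "i' \<in> W" "t < s" "t' < s"
  obtains f where "aut f" "\<And>l. f (stem i t b l) = stem i' t' b' l"
    "\<And>l. f (succ i t b l) = succ i' t' b' l"
proof -
  obtain g where g: "base.aut g" "g i = i'"
    using vertex_transitive assms by blast
  have "transpose t t' permutes {..<s}"
    using assms by (intro permutes_swap_id) auto
  then have "aut (lift g (transpose t t') (b \<noteq> b'))"
    by (rule aut_lift[OF g(1)])
  moreover have "(b \<noteq> (b \<noteq> b')) = b'" by auto
  ultimately show thesis
    using that[of "lift g (transpose t t') (b \<noteq> b')"]
    by (simp only: lift_stem lift_succ g(2) transpose_apply_first)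
qed

lemma o_v_flower: "o_v encoding = Suc m"
proof -
  have "o_v encoding = card (level ` {v. flower_vert v})"
  proof (rule o_v_encoding)
    fix u v assume "u \<in> {v. flower_vert v}" "v \<in> {v. flower_vert v}" "level u = level v"
    then show "\<exists>f. aut f \<and> f u = v"
      by (auto elim!: stem_cases) (metis aut_stem)
  qed (simp add: level_aut)
  moreover have "level ` {v. flower_vert v} = {..m}"
  proof
    show "{..m} \<subseteq> level ` {v. flower_vert v}"
    proof
      fix l assume "l \<in> {..m}"
      moreover obtain i where "i \<in> W" using base.nonempty_V by blast
      ultimately have "flower_vert (stem i 0 False l)" using s_pos by simp
      then show "l \<in> level ` {v. flower_vert v}" by (metis imageI level_stem mem_Collect_eq)
    qed
  qed (auto simp: level_le_m)
  ultimately show ?thesis by simp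
qed

text \<open>
  The level sum is \<open>2l + 1\<close> on the edges between levels \<open>l\<close> and \<open>l + 1\<close>, \<open>2m\<close> on the edges opposite
  to the core, and \<open>0\<close> on core edges, which are told apart by their numbers of triangles.
\<close>

definition edge_class :: "'a flower \<Rightarrow> 'a flower \<Rightarrow> nat \<times> nat" where
  "edge_class u v =
     (level u + level v, if level u + level v = 0 then common_nbrs u v else 0)"

lemma edge_class_commute: "edge_class u v = edge_class v u"
  by (simp add: edge_class_def add.commute common_nbrs_commute)

lemma edge_class_cong:
  assumes "{u, v} = {u', v'}"
  shows "edge_class u v = edge_class u' v'"
  using assms edge_class_commute by (auto simp: doubleton_eq_iff)

lemma edge_class_Core: "A i j \<Longrightarrow> edge_class (Core i) (Core j) = (0, base.common_nbrs i j)"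
  by (simp add: edge_class_def common_nbrs_Core)

text \<open>At \<open>l = m\<close> the value \<open>l + m\<close> is \<open>2 * m\<close>. Since
  \<open>m > 0\<close>, no level sum is 0 and the second component vanishes.\<close>

lemma edge_class_petal:
  "edge_class (stem i t b l) (succ i t b l) = (if l < m then 2 * l + 1 else l + m, 0)"
  using m_pos by (auto simp: edge_class_def level_succ)

lemma edge_class_aut: "aut f \<Longrightarrow> flower_adj u v \<Longrightarrow> edge_class (f u) (f v) = edge_class u v"
  using flower_adj_in_flower_vert[of u v] flower_adj_in_flower_vert[of v u] flower_adj_sym[of u v]
  by (simp add: edge_class_def level_aut aut_common_nbrs)

lemma edge_class_transitive:
  assumes "flower_adj u v" "flower_adj u' v'" and eq: "edge_class u v = edge_class u' v'"
  shows "\<exists>f. aut f \<and> {f u, f v} = {u', v'}"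
  using assms(1)
proof (cases rule: flower_adj_cases)
  case (core i j)
  show ?thesis
    using assms(2)
  proof (cases rule: flower_adj_cases)
    case core': (core i' j')
    then have "base.common_nbrs i j = base.common_nbrs i' j'"
      using eq core by (simp add: edge_class_Core)
    then obtain g where "base.aut g" "{g i, g j} = {i', j'}"
      using edge_transitive core core' by blast
    then have "aut (lift g id False)" "{lift g id False u, lift g id False v} = {u', v'}"
      using core core' by (auto simp: aut_lift permutes_id doubleton_eq_iff)
    then show ?thesis by blast
  next
    case (petal i' t b l)
    \<comment> \<open>A core edge has level sum 0, a petal edge a positive one.\<close>
    have False
      using eq core edge_class_cong[OF petal(1)] m_pos
      by (auto simp: edge_class_Core edge_class_petal split: if_splits)
    then show ?thesis ..
  qed
next
  case (petal i t b l)
  show ?thesis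
    using assms(2)
  proof (cases rule: flower_adj_cases)
    case (core i' j')
    have False
      using eq core edge_class_cong[OF petal(1)] m_pos
      by (auto simp: edge_class_Core edge_class_petal split: if_splits)
    then show ?thesis ..
  next
    case petal': (petal i' t' b' l')
    have "(if l < m then 2 * l + 1 else l + m) = (if l' < m then 2 * l' + 1 else l' + m)"
      using eq unfolding edge_class_cong[OF petal(1)] edge_class_cong[OF petal'(1)]
      by (simp add: edge_class_petal)
    \<comment> \<open>Odd sums \<open>2 * l + 1\<close> occur only for \<open>l < m\<close>, the
      even sum \<open>2 * m\<close> only for \<open>l = m\<close>.\<close>
    then have "l = l'"
      using petal(4) petal'(4) by (simp split: if_splits; presburger)
    obtain f where f: "aut f" "\<And>l. f (stem i t b l) = stem i' t' b' l"
        "\<And>l. f (succ i t b l) = succ i' t' b' l"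
      using aut_stem[OF petal(2) petal'(2) petal(3) petal'(3)] by blast
    have "{f u, f v} = f ` {u, v}" by simp
    also have "\<dots> = {u', v'}"
      unfolding petal(1) petal'(1) using \<open>l = l'\<close> by (simp add: f)
    finally show ?thesis using f(1) by blast
  qed
qed

text \<open>Petal edges form one class for each \<open>l \<le> m\<close>; core edges are classified
  by common neighbour counts, which are complete by \<open>edge_transitive\<close>.\<close>

lemma o_e_flower: "o_e encoding = Suc m + card {base.common_nbrs i j | i j. A i j}"
proof -
  let ?B = "{base.common_nbrs i j | i j. A i j}"
  let ?p = "\<lambda>l. (if l < m then 2 * l + 1 else l + m, 0 :: nat)"
  have "{edge_class u v | u v. flower_adj u v} = Pair 0 ` ?B \<union> ?p ` {..m}"
  proof (intro equalityI subsetI)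
    fix k assume "k \<in> {edge_class u v | u v. flower_adj u v}"
    then obtain u v where uv: "flower_adj u v" "k = edge_class u v" by blast
    from uv(1) show "k \<in> Pair 0 ` ?B \<union> ?p ` {..m}"
    proof (cases rule: flower_adj_cases)
      case (core i j)
      with uv show ?thesis by (auto simp: edge_class_Core)
    next
      case (petal i t b l)
      then have "k = ?p l"
        using uv edge_class_cong[OF petal(1)] by (simp add: edge_class_petal)
      with petal show ?thesis by blast
    qed
  next
    fix k assume "k \<in> Pair 0 ` ?B \<union> ?p ` {..m}"
    then consider i j where "A i j" "k = (0, base.common_nbrs i j)" | l where "l \<le> m" "k = ?p l"
      by blast
    then show "k \<in> {edge_class u v | u v. flower_adj u v}"
    proof cases
      case (1 i j)
      then have "flower_adj (Core i) (Core j)" "k = edge_class (Core i) (Core j)"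
        by (simp_all add: edge_class_Core)
      then show ?thesis by blast
    next
      case (2 l)
      obtain i where "i \<in> W" using base.nonempty_V by blast
      then have "flower_adj (stem i 0 False l) (succ i 0 False l)"
        using 2 s_pos by (intro flower_adj_stem_succ) auto
      moreover have "k = edge_class (stem i 0 False l) (succ i 0 False l)"
        using 2 by (simp only: edge_class_petal)
      ultimately show ?thesis by blast
    qed
  qed
  moreover have "card (Pair 0 ` ?B \<union> ?p ` {..m}) = card ?B + Suc m"
  proof -
    have "finite ?B"
      by (rule finite_subset[of _ "(\<lambda>(i, j). base.common_nbrs i j) ` (W \<times> W)"])
        (use base.E_in_V base.E_in_V2 base.finite_V in auto)
    moreover have "inj_on ?p {..m}"
      by (rule inj_onI) (simp split: if_splits; presburger)
    moreover have "Pair 0 ` ?B \<inter> ?p ` {..m} = {}"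
      using m_pos by (auto split: if_splits)
    ultimately show ?thesis
      by (subst card_Un_disjoint) (simp_all add: card_image inj_on_def[of "Pair 0"])
  qed
  moreover have "o_e encoding = card {edge_class u v | u v. flower_adj u v}"
    by (rule o_e_encoding[OF edge_class_commute edge_class_aut edge_class_transitive])
  ultimately show ?thesis by simp
qed

end

section \<open>Circulant graphs\<close>

text \<open>The bound \<open>n > 3 * e\<close> rules out triangles that wind around the cycle, which
  would disturb the common neighbour counts.\<close>

locale circulant =
  fixes n e :: nat
  assumes e_pos: "e > 0" and n_large: "n > 3 * e"
begin

definition W :: "int set" where
  "W = {0..<int n}"

text \<open>The second interval holds the residues of the negative steps.\<close>

definition steps :: "int set" where
  "steps = {1..int e} \<union> {int n - int e..<int n}"

definition A :: "int \<Rightarrow> int \<Rightarrow> bool" where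
  "A i j \<longleftrightarrow> i \<in> W \<and> j \<in> W \<and> (j - i) mod int n \<in> steps"

definition shift :: "int \<Rightarrow> int \<Rightarrow> int" where
  "shift a i = (i + a) mod int n"

lemma n_pos: "int n > 0"
  using n_large by simp

lemma mod_in_W [simp]: "a mod int n \<in> W"
  using n_pos by (simp add: W_def)

lemma W_mod [simp]: "i \<in> W \<Longrightarrow> i mod int n = i"
  by (simp add: W_def)

lemma shift_diff: "(shift a j - shift a i) mod int n = (j - i) mod int n"
  by (simp add: shift_def mod_diff_eq)

lemma shift_shift: "shift a (shift b i) = shift (a + b) i"
  by (simp add: shift_def mod_add_left_eq mod_add_right_eq ac_simps)

lemma shift_0 [simp]: "i \<in> W \<Longrightarrow> shift 0 i = i"
  by (simp add: shift_def)

lemma shift_to: "j \<in> W \<Longrightarrow> shift (j - i) i = j"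
  by (simp add: shift_def)

lemma shift_in_W [simp]: "shift a i \<in> W"
  by (simp add: shift_def)

lemma inj_on_shift: "inj_on (shift a) W"
  by (rule inj_on_inverseI[where g = "shift (- a)"]) (simp add: shift_shift)

lemma shift_image: "shift a ` W = W"
proof -
  have "i \<in> shift a ` W" if "i \<in> W" for i
    by (rule image_eqI[of _ _ "shift (- a) i"]) (simp_all add: shift_shift that)
  then show ?thesis by auto
qed

lemma steps_subset_W: "steps \<subseteq> W"
  using n_large by (auto simp: steps_def W_def)

lemma steps_minus: "(- d) mod int n \<in> steps \<longleftrightarrow> d mod int n \<in> steps"
proof -
  define c where "c = d mod int n"
  have "0 \<le> c" "c < int n" using n_pos by (auto simp: c_def)
  moreover have "(- d) mod int n = (if c = 0 then 0 else int n - c)"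
    by (simp add: zmod_zminus1_eq_if c_def)
  ultimately show ?thesis
    using n_large unfolding c_def[symmetric] by (auto simp: steps_def)
qed

lemma A_shift: "i \<in> W \<Longrightarrow> j \<in> W \<Longrightarrow> A (shift a i) (shift a j) \<longleftrightarrow> A i j"
  by (simp add: A_def shift_diff)

lemma A_commute: "A i j \<longleftrightarrow> A j i"
  using steps_minus[of "j - i"] by (auto simp: A_def)

text \<open>Connectedness: step 1 is available, so a closed set is stable under
  \<open>shift 1\<close> and contains all translates of its elements.\<close>

sublocale finite_graph W A
proof
  show "\<not> A i i" for i
    using n_large by (auto simp: A_def steps_def)
next
  fix S assume S: "S \<subseteq> W" "S \<noteq> {}" and closed: "\<And>i j. i \<in> S \<Longrightarrow> A i j \<Longrightarrow> j \<in> S"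
  have step: "shift 1 i \<in> S" if "i \<in> S" for i
  proof (rule closed[OF that])
    have "(shift 1 i - i) mod int n = 1 mod int n"
      by (simp add: shift_def mod_diff_left_eq)
    moreover have "1 mod int n \<in> steps" using e_pos n_large by (simp add: steps_def)
    ultimately show "A i (shift 1 i)" using S that by (auto simp: A_def)
  qed
  obtain i where i: "i \<in> S" using S by blast
  have reach: "shift (int k) i \<in> S" for k
  proof (induction k)
    case 0
    then show ?case using i S by auto
  next
    case (Suc k)
    then show ?case using step[OF Suc.IH] by (simp add: shift_shift)
  qed
  have "j \<in> S" if "j \<in> W" for j
  proof -
    have "shift (int (nat ((j - i) mod int n))) i = j"
      using n_pos that by (simp add: shift_def mod_add_right_eq)
    then show ?thesis using reach by metis
  qed
  with S show "S = W" by blast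
qed (use n_pos A_commute in \<open>auto simp: W_def A_def\<close>)

section \<open>Symmetry and common neighbour counts of the circulant graph\<close>

lemma aut_shift: "aut (shift a)"
  using A_shift shift_image inj_on_shift by (simp add: aut_def bij_betw_def)

lemma nbrs_0: "nbrs 0 = steps"
  using steps_subset_W n_pos by (auto simp: nbrs_def A_def W_def)

lemma card_nbrs:
  assumes "i \<in> W"
  shows "card (nbrs i) = 2 * e"
proof -
  have "card (nbrs i) = card (nbrs (shift i 0))"
    using assms by (simp add: shift_def)
  also have "\<dots> = card (nbrs 0)"
    using n_pos by (intro aut_card_nbrs aut_shift) (simp add: W_def)
  also have "\<dots> = 2 * e"
    unfolding nbrs_0 steps_def using n_large by (subst card_Un_disjoint) auto
  finally show ?thesis .
qed

text \<open>There are \<open>d - 1\<close> common neighbours strictly between 0 and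
  \<open>d\<close>, \<open>e - d\<close> beyond \<open>d\<close>, and \<open>e - d\<close> before 0
  modulo \<open>n\<close>.\<close>

lemma common_nbrs_0:
  assumes d: "1 \<le> d" "d \<le> int e"
  shows "common_nbrs 0 d = 2 * e - nat d - 1"
proof -
  have dW: "d \<in> W" using d n_large by (simp add: W_def)
  have "j \<in> nbrs 0 \<inter> nbrs d \<longleftrightarrow>
      j \<in> {1..d - 1} \<union> {d + 1..int e} \<union> {int n - int e + d..<int n}" for j
  proof (cases "j \<in> W")
    case True
    then have j: "0 \<le> j" "j < int n" by (auto simp: W_def)
    have "(j - d) mod int n = (if d \<le> j then j - d else j - d + int n)"
    proof (cases "d \<le> j")
      case False
      have "(j - d + int n) mod int n = j - d + int n"
        by (rule mod_pos_pos_trivial) (use False j d n_large in auto)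
      with False show ?thesis by simp
    qed (use j d in auto)
    then show ?thesis
      using True dW j d n_large unfolding nbrs_0
      by (auto simp: nbrs_def A_def steps_def)
  next
    case False
    then show ?thesis
      using d n_large nbrs_subset[of 0] by (auto simp: W_def)
  qed
  then have "nbrs 0 \<inter> nbrs d = {1..d - 1} \<union> {d + 1..int e} \<union> {int n - int e + d..<int n}"
    by blast
  moreover have "card ({1..d - 1} \<union> {d + 1..int e} \<union> {int n - int e + d..<int n}) =
      nat (d - 1) + nat (int e - d) + nat (int e - d)"
    using d n_large by (subst card_Un_disjoint; auto)+
  ultimately show ?thesis
    using d by (simp add: common_nbrs_def)
qed

text \<open>One orientation of the edge has its step in \<open>{1..e}\<close>, so the edge is a
  translate of some \<open>{0, d}\<close>.\<close>

lemma edge_normal_form: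
  assumes "A i j"
  obtains a d where "d \<in> {1..e}" "{shift a 0, shift a (int d)} = {i, j}"
    "common_nbrs i j = 2 * e - d - 1"
proof -
  have ij: "i \<in> W" "j \<in> W" using assms by (auto simp: A_def)
  obtain a b where ab: "{a, b} = {i, j}" "(b - a) mod int n \<in> {1..int e}"
  proof (cases "(j - i) mod int n \<in> {1..int e}")
    case False
    then have *: "int n - int e \<le> (j - i) mod int n" "(j - i) mod int n < int n"
      using assms by (auto simp: A_def steps_def)
    then have "(i - j) mod int n = int n - (j - i) mod int n"
      using zmod_zminus1_eq_if[of "j - i" "int n"] n_large by auto
    with * that[of j i] show thesis by auto
  qed (use that in blast)
  define d where "d = nat ((b - a) mod int n)"
  have d: "d \<in> {1..e}" "int d = (b - a) mod int n"
    using ab(2) by (auto simp: d_def)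
  have "a \<in> W" "b \<in> W" using ij ab(1) by (auto simp: doubleton_eq_iff)
  then have g: "shift a 0 = a" "shift a (int d) = b"
    unfolding d(2) by (simp_all add: shift_def mod_add_left_eq)
  have "common_nbrs i j = common_nbrs (shift a 0) (shift a (int d))"
    unfolding g using ab(1) by (auto simp: doubleton_eq_iff common_nbrs_commute)
  also have "\<dots> = common_nbrs 0 (int d)"
    using n_pos by (intro aut_common_nbrs aut_shift) (simp_all add: W_def d(2))
  also have "\<dots> = 2 * e - d - 1"
    using common_nbrs_0[of "int d"] d(1) by simp
  finally show thesis using that d(1) g ab(1) by metis
qed

lemma common_nbrs_image: "{common_nbrs i j | i j. A i j} = (\<lambda>d. 2 * e - d - 1) ` {1..e}"
proof (intro equalityI subsetI)
  fix k assume "k \<in> {common_nbrs i j | i j. A i j}"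
  then obtain i j where "A i j" "k = common_nbrs i j" by blast
  then show "k \<in> (\<lambda>d. 2 * e - d - 1) ` {1..e}"
    by (auto elim!: edge_normal_form)
next
  fix k assume "k \<in> (\<lambda>d. 2 * e - d - 1) ` {1..e}"
  then obtain d where d: "d \<in> {1..e}" "k = 2 * e - d - 1" by blast
  then have "A 0 (int d)" "k = common_nbrs 0 (int d)"
    using common_nbrs_0[of "int d"] n_large by (auto simp: A_def W_def steps_def)
  then show "k \<in> {common_nbrs i j | i j. A i j}" by blast
qed

lemma card_common_nbrs: "card {common_nbrs i j | i j. A i j} = e"
proof -
  \<comment> \<open>The subtraction never truncates, as \<open>d + 1 \<le> 2 * e\<close>.\<close>
  have "inj_on (\<lambda>d. 2 * e - d - 1) {1..e}"
    by (rule inj_onI) auto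
  then show ?thesis by (simp add: common_nbrs_image card_image)
qed

text \<open>Edges with equal counts have the same step, so translation by \<open>a' - a\<close>
  carries one to the other.\<close>

lemma transitive_flower:
  assumes "odd m"
  shows "transitive_flower_graph W A e m"
proof
  show "\<exists>g. aut g \<and> g i = j" if "i \<in> W" "j \<in> W" for i j
    using aut_shift shift_to[OF that(2)] by blast
next
  fix i j i' j'
  assume ij: "A i j" and ij': "A i' j'" and eq: "common_nbrs i j = common_nbrs i' j'"
  obtain a d where ad: "d \<in> {1..e}" "{shift a 0, shift a (int d)} = {i, j}"
      "common_nbrs i j = 2 * e - d - 1"
    by (rule edge_normal_form[OF ij])
  obtain a' d' where ad': "d' \<in> {1..e}" "{shift a' 0, shift a' (int d')} = {i', j'}"
      "common_nbrs i' j' = 2 * e - d' - 1"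
    by (rule edge_normal_form[OF ij'])
  have "d = d'" using eq ad(1,3) ad'(1,3) by auto
  have "{shift (a' - a) i, shift (a' - a) j} = shift (a' - a) ` {i, j}" by simp
  also have "\<dots> = {i', j'}"
    unfolding ad(2)[symmetric] ad'(2)[symmetric] \<open>d = d'\<close> by (simp add: shift_shift)
  finally show "\<exists>g. aut g \<and> {g i, g j} = {i', j'}" using aut_shift by blast
qed (use assms e_pos card_nbrs in auto)

end

section \<open>Choice of parameters and infinitely many graphs\<close>

lemma nut_graph_with_orbits:
  assumes "e > 0" "odd m" "n > 3 * e"
  shows "\<exists>G :: nat pair_pre_digraph. nut_graph G \<and> o_v G = Suc m \<and> o_e G = Suc m + e \<and>
    card (pverts G) = n * (1 + 2 * e * m)"
proof -
  interpret C: circulant n e using assms by unfold_locales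
  \<comment> \<open>The core has degree \<open>2 * e\<close>, so \<open>e\<close> petals are
    attached at each vertex.\<close>
  interpret F: transitive_flower_graph C.W C.A e m
    using assms(2) by (rule C.transitive_flower)
  have "card C.W = n" by (simp add: C.W_def)
  then show ?thesis
    using F.nut_graph_flower F.o_v_flower F.o_e_flower
    by (intro exI[of _ F.encoding]) (simp add: C.card_common_nbrs F.card_flower_vert F.card_pverts_encoding)
qed

theorem theorem33:
  fixes r :: nat
  assumes "r \<ge> 2" and "even r"
  shows "\<forall>k \<ge> r + 1. \<exists>\<G> :: nat pair_pre_digraph set.
           infinite \<G> \<and>
           pairwise (\<lambda>G H. \<not> digraph_iso (with_proj G) (with_proj H)) \<G> \<and>
           (\<forall>G \<in> \<G>. nut_graph G \<and> o_v G = r \<and> o_e G = k)"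
proof (intro allI impI)
  fix k assume k: "k \<ge> r + 1"
  \<comment> \<open>The orbit counts \<open>Suc m\<close> and \<open>Suc m + e\<close> dictate these
    values; \<open>k \<ge> r + 1\<close> makes \<open>e\<close> positive and even \<open>r\<close>
    makes \<open>m\<close> odd.\<close>
  define e where "e = k - r"
  define m where "m = r - 1"
  have em: "e > 0" "odd m" "Suc m = r" "Suc m + e = k"
    using k assms by (auto simp: e_def m_def)
  define good where "good n H \<longleftrightarrow> nut_graph H \<and> o_v H = r \<and> o_e H = k \<and>
    card (pverts H) = n * (1 + 2 * e * m)" for n and H :: "nat pair_pre_digraph"
  have "\<exists>H. good n H" if "n > 3 * e" for n
    using nut_graph_with_orbits[OF em(1,2) that] em(3,4) by (simp add: good_def)
  then obtain G where "\<And>n. n > 3 * e \<Longrightarrow> good n (G n)" by metis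
  then have G: "\<And>n. n > 3 * e \<Longrightarrow> nut_graph (G n) \<and> o_v (G n) = r \<and> o_e (G n) = k \<and>
      card (pverts (G n)) = n * (1 + 2 * e * m)"
    by (simp add: good_def)
  \<comment> \<open>The factor \<open>1 + 2 * e * m\<close> is positive, so the vertex count
    determines \<open>n\<close>. This yields both infinitude and pairwise non-isomorphism.\<close>
  have card_inj: "a = b" if "a > 3 * e" "b > 3 * e" "card (pverts (G a)) = card (pverts (G b))" for a b
  proof -
    have "a * (1 + 2 * e * m) = b * (1 + 2 * e * m)" using that G by metis
    then show ?thesis by (subst (asm) mult_cancel2) simp
  qed
  let ?\<G> = "G ` {3 * e<..}"
  have "inj_on G {3 * e<..}"
    by (rule inj_onI) (auto intro: card_inj)
  then have "infinite ?\<G>"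
    by (simp add: finite_image_iff infinite_Ioi)
  moreover have "pairwise (\<lambda>G H. \<not> digraph_iso (with_proj G) (with_proj H)) ?\<G>"
    unfolding pairwise_def using card_inj digraph_iso_card_pverts by blast
  ultimately show "\<exists>\<G> :: nat pair_pre_digraph set. infinite \<G> \<and>
      pairwise (\<lambda>G H. \<not> digraph_iso (with_proj G) (with_proj H)) \<G> \<and>
      (\<forall>G \<in> \<G>. nut_graph G \<and> o_v G = r \<and> o_e G = k)"
    using G by (intro exI[of _ ?\<G>]) auto
qed

end
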